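(* Let $\mathcal{A}$ be an $n\times n$ sign pattern. Then $\mathcal{A}$ allows the nSMP if and only if the largest composite cycle length in $D(\mathcal{A})$ is at least $n-1$.
   Context: A real $n\times n$ matrix $A$ has the non-symmetric strong multiplicity property (nSMP) if the only real $n\times n$ matrix $X$ satisfying all of (1) $A\circ X=O$ (entrywise product), (2) $AX^T-X^TA=O$, and (3) $\mathrm{tr}(X^TA^k)=0$ for all $0\le k<n$, is $X=O$ (the zero matrix). A sign pattern is an $n\times n$ matrix $\mathcal{A}$ with entries in $\{+,-,0\}$; $Q(\mathcal{A})$ is the set of real $n\times n$ matrices $A$ with $A_{ij}>0$ if $\mathcal{A}_{ij}=+$, $A_{ij}<0$ if $\mathcal{A}_{ij}=-$, and $A_{ij}=0$ if $\mathcal{A}_{ij}=0$. The pattern $\mathcal{A}$ allows a property if some $A\in Q(\mathcal{A})$ has the property. The digraph $D(\mathcal{A})$ has vertices $v_1,\dots,v_n$ and an arc from $v_i$ to $v_j$ if and only if $\mathcal{A}_{ij}\ne 0$ (loops allowed). A (simple, directed) $k$-cycle consists of $k$ distinct vertices $u_1,\dots,u_k$ and the arcs $(u_1,u_2),\dots,(u_{k-1},u_k),(u_k,u_1)$; a $1$-cycle is a loop. A composite cycle of length $k$ is a collection of pairwise vertex-disjoint simple cycles covering exactly $k$ vertices; the empty collection has length $0$. *)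

theory Defs
  imports "HOL-Analysis.Analysis" "Graph_Theory.Arc_Walk"
begin

text \<open>The order of the matrices is CARD('n), which is automatically at least 1.\<close>

definition hadamard :: "real^'n^'n \<Rightarrow> real^'n^'n \<Rightarrow> real^'n^'n" where
  "hadamard A B = (\<chi> i j. A $ i $ j * B $ i $ j)"

primrec mat_pow :: "real^'n^'n \<Rightarrow> nat \<Rightarrow> real^'n^'n" where
  "mat_pow A 0 = mat 1"
| "mat_pow A (Suc k) = A ** mat_pow A k"

definition nSMP :: "real^'n^'n \<Rightarrow> bool" where
  "nSMP A \<longleftrightarrow>
    (\<forall>X :: real^'n^'n.
       hadamard A X = 0 \<and>
       A ** transpose X - transpose X ** A = 0 \<and>
       (\<forall>k < CARD('n). trace (transpose X ** mat_pow A k) = 0)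
       \<longrightarrow> X = 0)"


datatype sign = Pos | Neg | Zero

primrec has_sign :: "real \<Rightarrow> sign \<Rightarrow> bool" where
  "has_sign x Pos \<longleftrightarrow> x > 0"
| "has_sign x Neg \<longleftrightarrow> x < 0"
| "has_sign x Zero \<longleftrightarrow> x = 0"

definition qual_class :: "sign^'n^'n \<Rightarrow> (real^'n^'n) set" where
  "qual_class P = {A. \<forall>i j. has_sign (A $ i $ j) (P $ i $ j)}"

definition allows :: "sign^'n^'n \<Rightarrow> (real^'n^'n \<Rightarrow> bool) \<Rightarrow> bool" where
  "allows P property \<longleftrightarrow> (\<exists>A \<in> qual_class P. property A)"


definition pattern_digraph :: "sign^'n^'n \<Rightarrow> ('n, 'n \<times> 'n) pre_digraph" where
  "pattern_digraph P =
    \<lparr>verts = UNIV, arcs = {(i, j). P $ i $ j \<noteq> Zero}, tail = fst, head = snd\<rparr>"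

text \<open>
  A simple cycle is a \<^const>\<open>pre_digraph.cycle\<close>, a nonempty list of arcs (loops are cycles).
  Every vertex of a cycle is the tail of one of its arcs.
\<close>

definition cycle_verts :: "('a, 'b) pre_digraph \<Rightarrow> 'b list \<Rightarrow> 'a set" where
  "cycle_verts G p = tail G ` set p"

text \<open>
  A simple cycle has several representations as an arc list, one for each starting vertex. They
  have the same vertices, so at most one of them can belong to a given composite cycle.
\<close>

definition composite_cycle :: "('a, 'b) pre_digraph \<Rightarrow> 'b list set \<Rightarrow> bool" where
  "composite_cycle G C \<longleftrightarrow>
    (\<forall>p \<in> C. pre_digraph.cycle G p) \<and>
    pairwise (\<lambda>p q. disjnt (cycle_verts G p) (cycle_verts G q)) C"

definition composite_cycle_length :: "('a, 'b) pre_digraph \<Rightarrow> 'b list set \<Rightarrow> nat" where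
  "composite_cycle_length G C = card (\<Union>p \<in> C. cycle_verts G p)"

definition max_composite_cycle_length :: "('a, 'b) pre_digraph \<Rightarrow> nat" where
  "max_composite_cycle_length G = Max (composite_cycle_length G ` {C. composite_cycle G C})"

text \<open>The maximum is taken over a finite nonempty set.\<close>

lemma finite_composite_cycle_lengths:
  fixes G :: "('a::finite, 'b) pre_digraph"
  shows "finite (composite_cycle_length G ` {C. composite_cycle G C})"
proof (rule finite_subset)
  show "composite_cycle_length G ` {C. composite_cycle G C} \<subseteq> {..CARD('a)}"
    by (auto simp: composite_cycle_length_def intro: card_mono)
qed simp

lemma zero_composite_cycle_length:
  "0 \<in> composite_cycle_length G ` {C. composite_cycle G C}"
  by (rule image_eqI[of _ _ "{}"]) (auto simp: composite_cycle_length_def composite_cycle_def)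

end

theory Submission
  imports Defs "HOL-Combinatorics.Orbits" "HOL-Computational_Algebra.Polynomial"
begin

text \<open>
  A composite cycle of length at least n - 1 amounts to a permutation \<pi> all of whose arcs belong to
  the digraph, except possibly a loop at one fixed point.

  If no such permutation exists, choose B of minimal nullity in the qualitative class near A. For
  B u = 0 and v B = 0, a perturbation of the (i, j) entry lowers the nullity as soon as v_i u_j is
  nonzero; hence v u^T vanishes on the support of the pattern. Moreover u and v can be taken
  orthogonal: either the nullity is at least 2, or an entry v_i u_i different from 0 would make
  B + E_ii invertible, and the Leibniz formula would yield a permutation \<pi>. Unit vectors u, v
  accumulate as B tends to A, and X = v u^T violates the nSMP of A.

  Conversely, a weighted permutation matrix of \<pi> whose absolute weights are constant on orbits and
  distinct on different orbits has n distinct complex eigenvalues, and conditions (2) and (3) alone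
  then force X = O. This property is open, so it survives filling in the remaining entries of the
  pattern with small values. The eigenvalues are avoided by working with the recurrences that the
  diagonal entries of Y A^k satisfy along the orbits.
\<close>

subsection \<open>Composite cycles and permutations\<close>

text \<open>The vertex list of a closed walk is its tails followed by the end vertex, and also the
  start vertex followed by its heads. Hence tails and heads agree as multisets, and distinctness,
  which \<open>cycle\<close> asserts of the heads, passes to the tails.\<close>

lemma cycle_arcs:
  assumes "pre_digraph.cycle G p"
  shows "set p \<subseteq> arcs G" "distinct (map (tail G) p)" "head G ` set p = tail G ` set p"
proof -
  interpret pre_digraph G .
  obtain u where u: "u \<in> verts G" "set p \<subseteq> arcs G" "cas u p u"
    "distinct (tl (awalk_verts u p))" "p \<noteq> []"
    using assms by (auto simp: cycle_def awalk_def)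
  have hd: "awalk_verts u p = tail G (hd p) # map (head G) p"
    using awalk_verts_conv'[OF u(3)] u(5) by simp
  have last: "awalk_verts u p = map (tail G) p @ [head G (last p)]"
    using awalk_verts_conv[of u p] u(5) by simp
  have "last (awalk_verts u p) = u"
    using u(3) by (rule cas.induct[of "\<lambda>u p v. cas u p v \<longrightarrow> last (awalk_verts u p) = v", THEN mp, rotated 2]) auto
  then have "head G (last p) = u" using last by simp
  moreover have "tail G (hd p) = u" using u(3,5) by (cases p) auto
  ultimately have "mset (map (tail G) p @ [u]) = mset (u # map (head G) p)"
    using hd last by metis
  then have m: "mset (map (tail G) p) = mset (map (head G) p)" by simp
  show "distinct (map (tail G) p)"
    using mset_eq_imp_distinct_iff[OF m] u(4) hd by simp
  show "head G ` set p = tail G ` set p" using mset_eq_setD[OF m] by simp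
  show "set p \<subseteq> arcs G" by (rule u(2))
qed

text \<open>Each vertex covered by \<open>C\<close> is the tail of exactly one arc of
  \<open>C\<close>; \<open>\<pi>\<close> sends it to the head of that arc.\<close>

lemma composite_cycle_imp_permutes:
  fixes G :: "('a::finite, 'b) pre_digraph"
  assumes C: "composite_cycle G C"
  obtains \<pi> where "\<pi> permutes (\<Union>p\<in>C. cycle_verts G p)"
    "\<And>v. v \<in> (\<Union>p\<in>C. cycle_verts G p) \<Longrightarrow> \<exists>e \<in> arcs G. tail G e = v \<and> head G e = \<pi> v"
proof -
  define E where "E = (\<Union>p\<in>C. set p)"
  define V where "V = (\<Union>p\<in>C. cycle_verts G p)"
  have cyc: "pre_digraph.cycle G p" if "p \<in> C" for p
    using C that by (auto simp: composite_cycle_def)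
  have arcs: "E \<subseteq> arcs G" using cycle_arcs(1)[OF cyc] by (auto simp: E_def)
  have V_tail: "V = tail G ` E" by (auto simp: V_def E_def cycle_verts_def)
  have "head G ` E = (\<Union>p\<in>C. head G ` set p)" by (auto simp: E_def)
  also have "\<dots> = V" using cycle_arcs(3)[OF cyc] by (simp add: V_def cycle_verts_def)
  finally have V_head: "V = head G ` E" ..
  have inj: "inj_on (tail G) E"
  proof (rule inj_onI)
    fix d e assume "d \<in> E" "e \<in> E" and eq: "tail G d = tail G e"
    then obtain p q where pq: "p \<in> C" "q \<in> C" "d \<in> set p" "e \<in> set q" by (auto simp: E_def)
    have "p = q"
      using C pq eq by (fastforce simp: composite_cycle_def pairwise_def disjnt_iff cycle_verts_def)
    then show "d = e"
      using cycle_arcs(2)[OF cyc[OF pq(1)]] pq eq by (auto simp: distinct_map dest: inj_onD)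
  qed
  define \<pi> where "\<pi> v = (if v \<in> V then head G (inv_into E (tail G) v) else v)" for v
  have \<pi>: "\<pi> (tail G e) = head G e" if "e \<in> E" for e
    using that inj by (simp add: \<pi>_def V_tail)
  have "\<pi> ` V = V" unfolding V_tail image_image using \<pi> V_head V_tail by (metis image_cong)
  then have "bij_betw \<pi> V V" by (simp add: bij_betw_def eq_card_imp_inj_on)
  then have "\<pi> permutes V" by (rule bij_imp_permutes) (simp add: \<pi>_def)
  moreover have "\<exists>e \<in> arcs G. tail G e = v \<and> head G e = \<pi> v" if "v \<in> V" for v
    using that \<pi> arcs by (auto simp: V_tail)
  ultimately show ?thesis using that unfolding V_def by blast
qed

text \<open>\<open>funpow_dist1 \<pi> i i\<close> is the first positive return time, so the walk
  goes round the orbit once and a fixed point yields a loop rather than the empty list.\<close>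

definition orbit_walk :: "('a \<Rightarrow> 'a) \<Rightarrow> 'a \<Rightarrow> ('a \<times> 'a) list" where
  "orbit_walk \<pi> i = map (\<lambda>l. ((\<pi> ^^ l) i, (\<pi> ^^ Suc l) i)) [0..<funpow_dist1 \<pi> i i]"

lemma cas_map_upt:
  assumes "tail G = fst" "head G = snd" "m \<le> k"
  shows "pre_digraph.cas G (f m) (map (\<lambda>l. (f l, f (Suc l))) [m..<k]) (f k)"
  using assms(3)
  by (induction rule: inc_induct) (auto simp: upt_conv_Cons pre_digraph.cas.simps assms)

lemma fst_orbit_walk:
  assumes "permutation \<pi>"
  shows "fst ` set (orbit_walk \<pi> i) = orbit \<pi> i"
  using orbit_conv_funpow_dist1[OF permutation_self_in_orbit[OF assms], of i]
  by (simp add: orbit_walk_def image_image del: upt_Suc)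

lemma cycle_orbit_walk:
  assumes G: "verts G = UNIV" "tail G = fst" "head G = snd"
    and \<pi>: "permutation \<pi>" and arcs: "\<And>j. j \<in> orbit \<pi> i \<Longrightarrow> (j, \<pi> j) \<in> arcs G"
  shows "pre_digraph.cycle G (orbit_walk \<pi> i)"
proof -
  interpret pre_digraph G .
  have self: "i \<in> orbit \<pi> i" using \<pi> by (rule permutation_self_in_orbit)
  have ne: "orbit_walk \<pi> i \<noteq> []" by (simp add: orbit_walk_def)
  have cas: "cas i (orbit_walk \<pi> i) i"
    using cas_map_upt[OF G(2,3), of 0 "funpow_dist1 \<pi> i i" "\<lambda>l. (\<pi> ^^ l) i"] funpow_dist1_prop[OF self]
    by (simp add: orbit_walk_def del: upt_Suc)
  have "(\<pi> ^^ l) i \<in> orbit \<pi> i" for l using self by (rule funpow_in_orbit)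
  then have "set (orbit_walk \<pi> i) \<subseteq> arcs G" using arcs by (auto simp: orbit_walk_def simp del: upt_Suc)
  then have "awalk i (orbit_walk \<pi> i) i" using G cas by (simp add: awalk_def)
  moreover have "distinct (tl (awalk_verts i (orbit_walk \<pi> i)))"
  proof -
    have "inj \<pi>" using \<pi> by (simp add: permutation_bijective bij_is_inj)
    \<comment> \<open>The tail of the vertex list consists of the heads, hence the extra
      \<open>\<pi>\<close> after the iterates.\<close>
    then have "inj_on (\<pi> \<circ> (\<lambda>l. (\<pi> ^^ l) i)) {0..<funpow_dist1 \<pi> i i}"
      by (intro comp_inj_on inj_on_funpow_dist1 self) (rule inj_on_subset, auto)
    then show ?thesis using awalk_verts_conv'[OF cas] ne G
      by (simp add: orbit_walk_def distinct_map comp_def del: upt_Suc)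
  qed
  ultimately show ?thesis using ne by (auto simp: cycle_def)
qed

text \<open>The one permitted zero entry is the fixed point that stands for a vertex missed by a composite
  cycle of length n - 1.\<close>

definition near_cover :: "sign^'n^'n \<Rightarrow> bool" where
  "near_cover P \<longleftrightarrow>
    (\<exists>\<pi> z. \<pi> permutes UNIV \<and> (\<forall>i. P $ i $ \<pi> i = Zero \<longrightarrow> i = z \<and> \<pi> i = i))"

text \<open>From left to right, the permutation of the covered set is extended by the identity to
  the at most one missed vertex. From right to left, the orbits become cycles; only the orbit
  \<open>{z}\<close> can fail to be one.\<close>

lemma max_composite_cycle_length_ge_iff:
  fixes P :: "sign^'n^'n"
  shows "max_composite_cycle_length (pattern_digraph P) \<ge> CARD('n) - 1 \<longleftrightarrow> near_cover P" (is "?L \<longleftrightarrow> ?R")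
proof
  let ?G = "pattern_digraph P"
  have G: "verts ?G = UNIV" "tail ?G = fst" "head ?G = snd" "arcs ?G = {(i, j). P $ i $ j \<noteq> Zero}"
    by (simp_all add: pattern_digraph_def)
  {
    assume ?L
    moreover have "max_composite_cycle_length ?G \<in> composite_cycle_length ?G ` {C. composite_cycle ?G C}"
      unfolding max_composite_cycle_length_def
      using zero_composite_cycle_length[of ?G] by (intro Max_in finite_composite_cycle_lengths) auto
    ultimately obtain C where C: "composite_cycle ?G C" "composite_cycle_length ?G C \<ge> CARD('n) - 1"
      by auto
    define V where "V = (\<Union>p\<in>C. cycle_verts ?G p)"
    obtain \<pi> where \<pi>: "\<pi> permutes V" "\<And>v. v \<in> V \<Longrightarrow> \<exists>e \<in> arcs ?G. tail ?G e = v \<and> head ?G e = \<pi> v"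
      using composite_cycle_imp_permutes[OF C(1)] unfolding V_def by blast
    have "card V \<ge> CARD('n) - 1" using C(2) by (simp add: composite_cycle_length_def V_def)
    then have "card (UNIV - V) \<le> Suc 0" by (simp add: card_Diff_subset)
    then have "\<forall>a\<in>UNIV - V. \<forall>b\<in>UNIV - V. a = b" by (subst (asm) card_le_Suc0_iff_eq) auto
    then obtain z where z: "UNIV - V \<subseteq> {z}" by blast
    have "\<pi> permutes UNIV" using \<pi>(1) by (rule permutes_subset) simp
    moreover have "i = z \<and> \<pi> i = i" if "P $ i $ \<pi> i = Zero" for i
    proof -
      have "i \<notin> V" using \<pi>(2)[of i] that G by auto
      then show ?thesis using z \<pi>(1) by (auto simp: permutes_not_in)
    qed
    ultimately show ?R unfolding near_cover_def by blast
  next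
    assume ?R
    then obtain \<pi> z where \<pi>: "\<pi> permutes UNIV" and z: "\<And>i. P $ i $ \<pi> i = Zero \<Longrightarrow> i = z \<and> \<pi> i = i"
      unfolding near_cover_def by blast
    have perm: "permutation \<pi>" using \<pi> by (auto simp: permutation_permutes)
    define \<O> where "\<O> = {Q \<in> range (orbit \<pi>). \<forall>j\<in>Q. P $ j $ \<pi> j \<noteq> Zero}"
    \<comment> \<open>One base point per orbit: arc lists with different base points in one orbit
      would count as different cycles sharing vertices.\<close>
    define r where "r Q = (SOME i. i \<in> Q)" for Q :: "'n set"
    have r: "orbit \<pi> (r Q) = Q" if Q: "Q \<in> \<O>" for Q
    proof -
      obtain i where i: "Q = orbit \<pi> i" using Q by (auto simp: \<O>_def)
      have "r Q \<in> Q" unfolding r_def by (rule someI[of _ "\<pi> i"]) (simp add: i orbit.base)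
      then show ?thesis using orbit_cyclic_eq3[OF cyclic_on_orbit'[OF perm, of i]] i by simp
    qed
    let ?C = "(\<lambda>Q. orbit_walk \<pi> (r Q)) ` \<O>"
    have verts: "cycle_verts ?G (orbit_walk \<pi> (r Q)) = Q" if "Q \<in> \<O>" for Q
      using r[OF that] by (simp add: cycle_verts_def G fst_orbit_walk[OF perm])
    have "pre_digraph.cycle ?G (orbit_walk \<pi> (r Q))" if "Q \<in> \<O>" for Q
      using that r[OF that] by (intro cycle_orbit_walk G perm) (auto simp: G \<O>_def)
    moreover have "disjnt Q R" if QR: "Q \<in> \<O>" "R \<in> \<O>" "Q \<noteq> R" for Q R
    proof -
      have "orbit \<pi> i = Q \<and> orbit \<pi> i = R" if "i \<in> Q" "i \<in> R" for i
        using QR(1,2) that orbit_cyclic_eq3[OF cyclic_on_orbit'[OF perm]] unfolding \<O>_def by blast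
      then show ?thesis using QR(3) by (auto simp: disjnt_iff)
    qed
    ultimately have "composite_cycle ?G ?C"
      by (auto simp: composite_cycle_def pairwise_def verts)
    then have "composite_cycle_length ?G ?C \<le> max_composite_cycle_length ?G"
      unfolding max_composite_cycle_length_def
      by (intro Max_ge finite_composite_cycle_lengths) auto
    moreover have "composite_cycle_length ?G ?C = card (\<Union>\<O>)"
      by (simp add: composite_cycle_length_def verts)
    moreover have "CARD('n) - 1 \<le> card (\<Union>\<O>)"
    proof -
      have "i \<in> \<Union>\<O>" if "i \<noteq> z" for i
      proof -
        have i: "i \<in> orbit \<pi> i" by (rule permutation_self_in_orbit[OF perm])
        have "P $ j $ \<pi> j \<noteq> Zero" if j: "j \<in> orbit \<pi> i" for j
        proof
          assume "P $ j $ \<pi> j = Zero"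
          then have "j = z" "\<pi> j = j" using z by auto
          then have "orbit \<pi> j = {z}" by (simp add: orbit_eq_singleton_iff)
          then show False
            using orbit_cyclic_eq3[OF cyclic_on_orbit'[OF perm, of i] j] i \<open>i \<noteq> z\<close> by simp
        qed
        then show ?thesis using i by (auto simp: \<O>_def)
      qed
      then have "card (UNIV - {z}) \<le> card (\<Union>\<O>)" by (intro card_mono) auto
      then show ?thesis by (simp add: card_Diff_subset)
    qed
    ultimately show ?L by simp
  }
qed

subsection \<open>Patterns without long composite cycles\<close>

text \<open>Some term of the Leibniz expansion is nonzero.\<close>

lemma det_nonzero_imp_permutation:
  fixes A :: "real^'n^'n"
  assumes "det A \<noteq> 0"
  obtains \<pi> where "\<pi> permutes UNIV" "\<And>i. A $ i $ \<pi> i \<noteq> 0"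
proof -
  obtain \<pi> where "\<pi> permutes (UNIV :: 'n set)" "(\<Prod>i\<in>UNIV. A $ i $ \<pi> i) \<noteq> 0"
    using assms unfolding det_def by (auto elim!: sum.not_neutral_contains_not_neutral)
  then show ?thesis using that by auto
qed

section \<open>Kernels and their dimension\<close>

lemma det_nonzero_iff_kernel:
  fixes A :: "real^'n^'n"
  shows "det A \<noteq> 0 \<longleftrightarrow> (\<forall>x. A *v x = 0 \<longrightarrow> x = 0)"
  using invertible_det_nz[of A] invertible_left_inverse[of A] matrix_left_invertible_ker[of A] by blast

lemma subspace_kernel: "subspace {x. (A :: real^'n^'m) *v x = 0}"
  by (auto simp: subspace_def matrix_vector_right_distrib vector_scalar_commute[symmetric]
      matrix_vector_mult_scaleR)

lemma axis_axis_mult_vec: "axis i (axis j s) *v x = axis i (s * x $ j)"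
  for s :: real
proof -
  have "(axis i (axis j s) *v x) $ k = axis i (s * x $ j) $ k" for k
  proof (cases "k = i")
    case True
    then show ?thesis by (simp add: matrix_vector_mul_component inner_axis')
  next
    case False
    then have "axis i (axis j s) $ k = 0" "axis i (s * x $ j) $ k = 0" by (simp_all add: axis_def)
    then show ?thesis by (simp add: matrix_vector_mul_component)
  qed
  then show ?thesis by (simp add: vec_eq_iff)
qed

text \<open>Pairing the perturbed equation with the left null vector \<open>v\<close> leaves
  \<open>v $ i * (s * x $ j) = 0\<close>. So the new kernel lies in the part of the kernel of
  \<open>B\<close> where \<open>x $ j = 0\<close>, and \<open>u\<close> is outside that
  part.\<close>

lemma dim_kernel_add_unit_less:
  fixes B :: "real^'n^'m"
  assumes "B *v u = 0" "v v* B = 0" "v $ i \<noteq> 0" "u $ j \<noteq> 0" "s \<noteq> 0"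
  shows "dim {x. (B + axis i (axis j s)) *v x = 0} < dim {x. B *v x = 0}"
proof -
  let ?E = "axis i (axis j s) :: real^'n^'m"
  have *: "x $ j = 0 \<and> B *v x = 0" if x: "(B + ?E) *v x = 0" for x
  proof -
    have sum: "B *v x + axis i (s * x $ j) = 0"
      using x by (simp add: matrix_vector_mult_add_rdistrib axis_axis_mult_vec)
    then have "v \<bullet> (B *v x) + v \<bullet> axis i (s * x $ j) = 0"
      by (metis inner_add_right inner_zero_right)
    then have "v $ i * (s * x $ j) = 0"
      using assms(2) by (simp add: dot_lmul_matrix[symmetric] inner_axis)
    then have "x $ j = 0" using assms(3,5) by simp
    then show ?thesis using sum by (simp add: axis_def vec_eq_iff)
  qed
  have "u \<notin> {x. (B + ?E) *v x = 0}" using *[of u] assms(4) by auto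
  then have "{x. (B + ?E) *v x = 0} \<noteq> {x. B *v x = 0}" using assms(1) by auto
  moreover have sub: "{x. (B + ?E) *v x = 0} \<subseteq> {x. B *v x = 0}" using * by auto
  ultimately show ?thesis
    using subspace_dim_equal[OF subspace_kernel subspace_kernel sub] by force
qed

text \<open>If no such \<open>u\<close> existed, the functional \<open>v \<bullet> x\<close> would
  be injective on \<open>S\<close>, so a single vector would span \<open>S\<close>.\<close>

lemma exists_orthogonal_in_subspace:
  fixes v :: "'a::euclidean_space"
  assumes "subspace S" "dim S \<ge> 2"
  obtains u where "u \<in> S" "u \<noteq> 0" "v \<bullet> u = 0"
proof -
  have "\<exists>u\<in>S. u \<noteq> 0 \<and> v \<bullet> u = 0"
  proof (rule ccontr)
    assume contra: "\<not> ?thesis"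
    obtain w where w: "w \<in> S" "w \<noteq> 0" using assms(2) dim_eq_0[of S] by fastforce
    have "x \<in> span {w}" if x: "x \<in> S" for x
    proof -
      let ?y = "(v \<bullet> w) *\<^sub>R x - (v \<bullet> x) *\<^sub>R w"
      have "?y \<in> S" using x w assms(1) by (simp add: subspace_diff subspace_mul)
      moreover have "v \<bullet> ?y = 0" by (simp add: inner_diff_right)
      ultimately have "?y = 0" using contra by blast
      moreover have vw: "v \<bullet> w \<noteq> 0" using contra w by blast
      ultimately have "x = ((v \<bullet> x) / (v \<bullet> w)) *\<^sub>R w"
        by (simp add: eq_vector_fraction_iff)
      then show ?thesis by (metis span_base span_mul singletonI)
    qed
    then have "dim S \<le> dim {w}" by (metis dim_span dim_subset subsetI)
    then show False using assms(2) dim_le_card[of "{w}" "{w}"] by (auto simp: span_base)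
  qed
  then show ?thesis using that by blast
qed

section \<open>Changing one entry within a qualitative class\<close>

lemma qual_classD: "B \<in> qual_class P \<Longrightarrow> has_sign (B $ i $ j) (P $ i $ j)"
  by (simp add: qual_class_def)

lemma qual_class_perturb_entry:
  fixes A :: "real^'n^'n"
  assumes "B \<in> qual_class P" "dist A B < e" "P $ i $ j \<noteq> Zero"
  obtains s where "s \<noteq> 0" "B + axis i (axis j s) \<in> qual_class P" "dist A (B + axis i (axis j s)) < e"
proof -
  have nz: "B $ i $ j \<noteq> 0" using assms(3)
    using qual_classD[OF assms(1), of i j] by (cases "P $ i $ j") auto
  \<comment> \<open>Below the modulus of the entry the sign is kept; below the remaining distance
    the matrix stays in the ball.\<close>
  define s where "s = min (\<bar>B $ i $ j\<bar> / 2) ((e - dist A B) / 2)"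
  have s: "s > 0" "s < \<bar>B $ i $ j\<bar>" "s < e - dist A B"
    using nz assms(2) by (auto simp: s_def min_def)
  have "B + axis i (axis j s) \<in> qual_class P"
  proof -
    have "has_sign ((B + axis i (axis j s)) $ a $ b) (P $ a $ b)" for a b
    proof (cases "a = i \<and> b = j")
      case True
      then show ?thesis using assms(3) s qual_classD[OF assms(1), of i j]
        by (cases "P $ i $ j") (auto simp: axis_def)
    next
      case False
      then have "axis i (axis j s) $ a $ b = 0" by (auto simp: axis_def)
      then show ?thesis using assms(1) by (simp add: qual_class_def)
    qed
    then show ?thesis by (simp add: qual_class_def)
  qed
  moreover have "dist A (B + axis i (axis j s)) < e"
  proof -
    have "norm (axis i (axis j s) :: real^'n^'n) = s"
      using s(1) by (simp add: norm_eq_sqrt_inner inner_axis_axis)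
    then have "dist B (B + axis i (axis j s)) = s" by (simp add: dist_norm)
    then show ?thesis using s(3) dist_triangle[of A "B + axis i (axis j s)" B] by linarith
  qed
  ultimately show ?thesis using that[of s] s(1) by simp
qed

lemma qual_class_Zero: "B \<in> qual_class P \<Longrightarrow> P $ i $ j = Zero \<Longrightarrow> B $ i $ j = 0"
  using qual_classD[of B P i j] by simp

text \<open>The Leibniz formula yields a permutation through nonzero entries. Only position
  \<open>(i, i)\<close> may lie outside the pattern, and using it means fixing \<open>i\<close>. The
  case \<open>s = 0\<close> covers \<open>det B\<close> itself.\<close>

lemma qual_class_det_nonzero_imp_near_cover:
  fixes B :: "real^'n^'n"
  assumes "B \<in> qual_class P" "det (B + axis i (axis i s)) \<noteq> 0"
  shows "near_cover P"
proof -
  obtain \<pi> where \<pi>: "\<pi> permutes UNIV" "\<And>k. (B + axis i (axis i s)) $ k $ \<pi> k \<noteq> 0"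
    using det_nonzero_imp_permutation[OF assms(2)] by metis
  have "k = i \<and> \<pi> k = k" if "P $ k $ \<pi> k = Zero" for k
  proof -
    have "B $ k $ \<pi> k = 0" using assms(1) that by (rule qual_class_Zero)
    then have "axis i (axis i s) $ k $ \<pi> k \<noteq> 0" using \<pi>(2)[of k] by simp
    then show ?thesis by (auto simp: axis_def split: if_splits)
  qed
  then show ?thesis unfolding near_cover_def using \<pi>(1) by blast
qed

text \<open>Without a near cover all matrices of the class are singular, and remain so after
  changing a single diagonal entry. The first fact gives null vectors, the second their
  orthogonality at nullity 1, and minimality of the nullity the vanishing products.\<close>

lemma null_vectors_of_minimal_nullity:
  fixes A :: "real^'n^'n"
  assumes A: "A \<in> qual_class P" and nc: "\<not> near_cover P" and e: "e > 0"
  obtains B u v where "dist A B < e" "norm u = 1" "norm v = 1" "B *v u = 0" "v v* B = 0"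
    "v \<bullet> u = 0" "\<And>i j. P $ i $ j \<noteq> Zero \<Longrightarrow> v $ i * u $ j = 0"
proof -
  define null where "null B = dim {x. B *v x = 0}" for B :: "real^'n^'n"
  obtain B where B: "B \<in> qual_class P" "dist A B < e"
    and min: "\<And>B'. B' \<in> qual_class P \<Longrightarrow> dist A B' < e \<Longrightarrow> null B \<le> null B'"
    using ex_has_least_nat[of "\<lambda>B. B \<in> qual_class P \<and> dist A B < e" A null] A e by auto
  \<comment> \<open>The instance \<open>s = 0\<close>, at an arbitrary index.\<close>
  have "det (B + axis undefined (axis undefined 0)) = 0"
    using qual_class_det_nonzero_imp_near_cover[OF B(1)] nc by blast
  then have det: "det B = 0" by (simp add: axis_def zero_vec_def[symmetric] cong: if_cong)
  then obtain v where v: "v \<noteq> 0" "v v* B = 0"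
    using det_nonzero_iff_kernel[of "transpose B"] by (auto simp: det_transpose)
  have "\<exists>u. u \<noteq> 0 \<and> B *v u = 0 \<and> v \<bullet> u = 0"
  proof (cases "null B \<ge> 2")
    case True
    then show ?thesis
      using exists_orthogonal_in_subspace[OF subspace_kernel, of B v] unfolding null_def by auto
  next
    case False
    obtain u where u: "u \<noteq> 0" "B *v u = 0" using det det_nonzero_iff_kernel[of B] by blast
    have "v \<bullet> u = 0"
    proof (rule ccontr)
      assume "v \<bullet> u \<noteq> 0"
      then obtain i where "v $ i \<noteq> 0" "u $ i \<noteq> 0"
        unfolding inner_vec_def by (auto elim!: sum.not_neutral_contains_not_neutral)
      \<comment> \<open>Position \<open>(i, i)\<close> may lie outside the pattern, so minimality
        cannot be invoked; instead the kernel, of dimension at most 1, drops to zero.\<close>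
      then have "null (B + axis i (axis i 1)) < null B"
        unfolding null_def by (intro dim_kernel_add_unit_less[OF u(2) v(2)]) auto
      then have "null (B + axis i (axis i 1)) = 0" using False by simp
      then have "det (B + axis i (axis i 1)) \<noteq> 0"
        unfolding det_nonzero_iff_kernel null_def dim_eq_0 by auto
      then show False using qual_class_det_nonzero_imp_near_cover[OF B(1)] nc by blast
    qed
    then show ?thesis using u by blast
  qed
  then obtain u where u: "u \<noteq> 0" "B *v u = 0" "v \<bullet> u = 0" by blast
  \<comment> \<open>Here the perturbed matrix stays in the class and in the ball, so a smaller
    kernel contradicts minimality.\<close>
  have "v $ i * u $ j = 0" if nz: "P $ i $ j \<noteq> Zero" for i j
  proof (rule ccontr)
    assume "v $ i * u $ j \<noteq> 0"
    then have vu: "v $ i \<noteq> 0" "u $ j \<noteq> 0" by auto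
    obtain s where s: "s \<noteq> 0" "B + axis i (axis j s) \<in> qual_class P" "dist A (B + axis i (axis j s)) < e"
      using qual_class_perturb_entry[OF B nz] by blast
    then show False
      using dim_kernel_add_unit_less[OF u(2) v(2) vu s(1)] min[OF s(2,3)] by (simp add: null_def)
  qed
  moreover have "(v /\<^sub>R norm v) v* B = 0"
    by (metis matrix_vector_mult_scaleR scaleR_zero_right transpose_matrix_vector v(2))
  ultimately show ?thesis
    using that[of B "u /\<^sub>R norm u" "v /\<^sub>R norm v"] B u v
    by (auto simp: matrix_vector_mult_scaleR)
qed

section \<open>Passage to the limit\<close>

lemma tendsto_matrix_vector_mult:
  fixes A :: "'a \<Rightarrow> real^'n^'m"
  assumes "(A \<longlongrightarrow> B) F" "(x \<longlongrightarrow> y) F"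
  shows "((\<lambda>t. A t *v x t) \<longlongrightarrow> B *v y) F"
  unfolding matrix_vector_mult_def by (intro tendsto_intros assms)

lemma tendsto_vector_matrix_mult:
  fixes A :: "'a \<Rightarrow> real^'n^'m"
  assumes "(A \<longlongrightarrow> B) F" "(x \<longlongrightarrow> y) F"
  shows "((\<lambda>t. x t v* A t) \<longlongrightarrow> y v* B) F"
  unfolding vector_matrix_mult_def by (intro tendsto_intros assms)

text \<open>\<open>A\<close> itself need not have minimal nullity, but suitable null vectors exist
  for matrices arbitrarily near \<open>A\<close>. Unit length keeps their limits nonzero, and all
  the equations are closed conditions.\<close>

lemma nSMP_imp_near_cover:
  fixes A :: "real^'n^'n"
  assumes A: "A \<in> qual_class P" and nSMP: "nSMP A"
  shows "near_cover P"
proof (rule ccontr)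
  assume nc: "\<not> near_cover P"
  have "\<exists>B u v. dist A B < 1 / Suc n \<and> norm u = 1 \<and> norm v = 1 \<and> B *v u = 0 \<and> v v* B = 0 \<and>
      v \<bullet> u = 0 \<and> (\<forall>i j. P $ i $ j \<noteq> Zero \<longrightarrow> v $ i * u $ j = 0)" for n
    using null_vectors_of_minimal_nullity[OF A nc, of "1 / Suc n"]
    by (metis of_nat_0_less_iff zero_less_Suc zero_less_divide_1_iff)
  then obtain B u v where B: "\<And>n. dist A (B n) < 1 / Suc n"
    and norm: "\<And>n. norm (u n) = 1" "\<And>n. norm (v n) = 1"
    and eq: "\<And>n. B n *v u n = 0" "\<And>n. v n v* B n = 0" "\<And>n. v n \<bullet> u n = 0"
      "\<And>n i j. P $ i $ j \<noteq> Zero \<Longrightarrow> v n $ i * u n $ j = 0"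
    by metis
  have "dist (B n) A \<le> 1 / Suc n" for n using B[of n] by (simp add: dist_commute)
  then have "(\<lambda>n. dist (B n) A) \<longlonglongrightarrow> 0"
    using tendsto_sandwich[OF _ _ tendsto_const lim_inverse_n'[THEN LIMSEQ_Suc]]
    by (simp add: always_eventually)
  then have B_lim: "B \<longlonglongrightarrow> A" by (subst tendsto_dist_iff)
  have "compact (sphere 0 1 \<times> sphere 0 1 :: ((real^'n) \<times> (real^'n)) set)"
    by (intro compact_Times compact_sphere)
  moreover have "\<forall>n. (u n, v n) \<in> sphere 0 1 \<times> sphere 0 1" using norm by simp
  ultimately obtain l and r :: "nat \<Rightarrow> nat" where l: "l \<in> sphere 0 1 \<times> sphere 0 1"
    and r: "strict_mono r" and lim: "((\<lambda>n. (u n, v n)) \<circ> r) \<longlonglongrightarrow> l"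
    by (rule seq_compactE[OF compact_imp_seq_compact])
  obtain x y where xy: "l = (x, y)" by fastforce
  have lims: "(\<lambda>n. u (r n)) \<longlonglongrightarrow> x" "(\<lambda>n. v (r n)) \<longlonglongrightarrow> y" "(\<lambda>n. B (r n)) \<longlonglongrightarrow> A"
    using tendsto_fst[OF lim] tendsto_snd[OF lim] LIMSEQ_subseq_LIMSEQ[OF B_lim r] xy by (auto simp: comp_def)
  have x: "A *v x = 0"
    using tendsto_matrix_vector_mult[OF lims(3,1)] eq(1) by (simp add: LIMSEQ_const_iff)
  have y: "y v* A = 0"
    using tendsto_vector_matrix_mult[OF lims(3,2)] eq(2) by (simp add: LIMSEQ_const_iff)
  have yx: "y \<bullet> x = 0"
    using tendsto_inner[OF lims(2,1)] eq(3) by (simp add: LIMSEQ_const_iff)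
  have supp: "y $ i * x $ j = 0" if "P $ i $ j \<noteq> Zero" for i j
    using tendsto_mult[OF tendsto_vec_nth[OF lims(2), of i] tendsto_vec_nth[OF lims(1), of j]]
      eq(4)[OF that] by (simp add: LIMSEQ_const_iff)
  \<comment> \<open>Both products of \<open>A\<close> with \<open>transpose X\<close> vanish
    separately. The trace for \<open>k = 0\<close> is \<open>y \<bullet> x\<close>, and every later
    one contains the factor \<open>transpose X ** A\<close>.\<close>
  define X :: "real^'n^'n" where "X = (\<chi> i j. y $ i * x $ j)"
  have "hadamard A X = 0"
    using supp qual_class_Zero[OF A] by (fastforce simp: hadamard_def X_def vec_eq_iff)
  moreover have AX: "A ** transpose X = 0"
  proof -
    have "(A ** transpose X) $ i $ k = (A *v x) $ i * y $ k" for i k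
      by (simp add: matrix_matrix_mult_def matrix_vector_mult_def transpose_def X_def sum_distrib_left mult_ac)
    then show ?thesis using x by (simp add: vec_eq_iff)
  qed
  moreover have XA: "transpose X ** A = 0"
  proof -
    have "(transpose X ** A) $ i $ k = x $ i * (y v* A) $ k" for i k
      by (simp add: matrix_matrix_mult_def vector_matrix_mult_def transpose_def X_def sum_distrib_left mult_ac)
    then show ?thesis using y by (simp add: vec_eq_iff)
  qed
  moreover have "trace (transpose X ** mat_pow A k) = 0" for k
  proof (cases k)
    case 0
    then show ?thesis using yx by (simp add: trace_def transpose_def X_def inner_vec_def)
  next
    case (Suc m)
    then show ?thesis using XA by (simp add: matrix_mul_assoc trace_def)
  qed
  ultimately have "X = 0" using nSMP unfolding nSMP_def by simp
  then have "X $ i $ j = 0" for i j by simp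
  then have "x = 0 \<or> y = 0" by (auto simp: X_def vec_eq_iff)
  then show False using l xy by auto
qed

subsection \<open>Sequences with binomial recurrences\<close>

text \<open>The linear functional on polynomials that sends \<open>x^i\<close> to
  \<open>s i\<close>. Multiplication by \<open>x\<close> becomes a shift of \<open>s\<close>, so a
  linear recurrence becomes the vanishing of the functional on the multiples of a
  polynomial.\<close>

definition umbral :: "(nat \<Rightarrow> real) \<Rightarrow> real poly \<Rightarrow> real" where
  "umbral s p = (\<Sum>i\<le>degree p. coeff p i * s i)"

lemma umbral_eq_sum: "degree p \<le> n \<Longrightarrow> umbral s p = (\<Sum>i\<le>n. coeff p i * s i)"
  unfolding umbral_def by (rule sum.mono_neutral_left) (auto simp: coeff_eq_0)

lemma umbral_0 [simp]: "umbral s 0 = 0"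
  by (simp add: umbral_def)

lemma umbral_add: "umbral s (p + q) = umbral s p + umbral s q"
proof -
  have "degree (p + q) \<le> max (degree p) (degree q)" by (rule degree_add_le_max)
  then show ?thesis
    by (simp add: umbral_eq_sum[of _ "max (degree p) (degree q)"] algebra_simps sum.distrib)
qed

lemma umbral_smult: "umbral s (smult c p) = c * umbral s p"
  using degree_smult_le[of c p]
  by (simp add: umbral_eq_sum[of _ "degree p"] sum_distrib_left mult_ac)

lemma umbral_scale: "umbral (\<lambda>k. c * s k) p = c * umbral s p"
  by (simp add: umbral_def sum_distrib_left mult_ac)

lemma umbral_pCons: "umbral s (pCons a p) = a * s 0 + umbral (\<lambda>k. s (Suc k)) p"
proof -
  have "degree (pCons a p) \<le> Suc (degree p)" by (rule degree_pCons_le)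
  then have "umbral s (pCons a p) = (\<Sum>i\<le>Suc (degree p). coeff (pCons a p) i * s i)"
    by (rule umbral_eq_sum)
  then show ?thesis by (simp add: sum.atMost_Suc_shift umbral_def del: sum.atMost_Suc)
qed

lemma umbral_monom_mult: "umbral s (monom 1 d * p) = umbral (\<lambda>k. s (k + d)) p"
  by (induction d arbitrary: s) (simp_all add: monom_Suc umbral_pCons)

lemma umbral_recurrence:
  assumes "\<And>k. s (k + d) = \<sigma> * s k"
  shows "umbral s ((monom 1 d - [:\<sigma>:]) * p) = 0"
proof -
  have "(monom 1 d - [:\<sigma>:]) * p = monom 1 d * p + smult (- \<sigma>) p"
    by (simp add: algebra_simps)
  then show ?thesis
    by (simp add: umbral_add umbral_monom_mult umbral_smult umbral_scale assms del: smult_minus_left)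
qed

text \<open>The hypothesis says that the functional kills every \<open>x^m * q\<close>. Induction on
  the coefficients of \<open>p\<close> extends this linearly, shifting \<open>s\<close> at each
  step.\<close>

lemma umbral_mult_zero:
  assumes "\<And>m. umbral (\<lambda>k. s (k + m)) q = 0"
  shows "umbral s (p * q) = 0"
  using assms
proof (induction p arbitrary: s)
  case (pCons a p)
  have "umbral (\<lambda>k. s (Suc k)) (p * q) = 0"
    using pCons.prems[of "Suc _"] by (intro pCons.IH) simp
  then show ?case using pCons.prems[of 0] by (simp add: umbral_add umbral_smult umbral_pCons)
qed simp

text \<open>The two binomials divide \<open>x^(a*b) - \<sigma>^b\<close> and
  \<open>x^(a*b) - \<tau>^a\<close>, and these multiples differ by a nonzero constant.\<close>

lemma bezout_binomials:
  fixes \<sigma> \<tau> :: real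
  assumes "\<sigma> ^ b \<noteq> \<tau> ^ a"
  shows "\<exists>u v. u * (monom 1 a - [:\<sigma>:]) + v * (monom 1 b - [:\<tau>:]) = 1"
proof -
  have dvd: "(monom 1 a - [:\<sigma>:]) dvd (monom 1 (a * b) - [:\<sigma> ^ b:])" for a b and \<sigma> :: real
  proof -
    have "(monom 1 a - [:\<sigma>:]) dvd (monom 1 a ^ b - [:\<sigma>:] ^ b)"
      unfolding power_diff_sumr2 by simp
    then show ?thesis by (simp add: monom_power poly_const_pow)
  qed
  obtain g where g: "monom 1 (a * b) - [:\<sigma> ^ b:] = (monom 1 a - [:\<sigma>:]) * g"
    using dvd[of a \<sigma> b] by (elim dvdE)
  obtain h where h: "monom 1 (a * b) - [:\<tau> ^ a:] = (monom 1 b - [:\<tau>:]) * h"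
    using dvd[of b \<tau> a] by (metis dvdE mult.commute)
  have "h * (monom 1 b - [:\<tau>:]) - g * (monom 1 a - [:\<sigma>:]) =
      (monom 1 (a * b) - [:\<tau> ^ a:]) - (monom 1 (a * b) - [:\<sigma> ^ b:])" (is "?e = _")
    unfolding g h by (simp only: mult.commute)
  also have "\<dots> = [:\<sigma> ^ b - \<tau> ^ a:]" by simp
  finally have "?e = [:\<sigma> ^ b - \<tau> ^ a:]" .
  then have "smult (1 / (\<sigma> ^ b - \<tau> ^ a)) ?e = 1"
    using assms by (simp add: pCons_one)
  then have "smult (- 1 / (\<sigma> ^ b - \<tau> ^ a)) g * (monom 1 a - [:\<sigma>:])
      + smult (1 / (\<sigma> ^ b - \<tau> ^ a)) h * (monom 1 b - [:\<tau>:]) = 1"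
    by (simp add: smult_diff_right)
  then show ?thesis by blast
qed

text \<open>In the product of two Bezout relations every term but the one with \<open>v * v'\<close>
  is a multiple of \<open>f\<close>.\<close>

lemma bezout_prod:
  fixes f :: "'a::comm_ring_1"
  assumes "finite I" "\<And>b. b \<in> I \<Longrightarrow> \<exists>u v. u * f + v * g b = 1"
  shows "\<exists>u v. u * f + v * (\<Prod>b\<in>I. g b) = 1"
  using assms
proof (induction I rule: finite_induct)
  case empty
  have "0 * f + 1 * (\<Prod>b\<in>{}. g b) = 1" by simp
  then show ?case by blast
next
  case (insert b I)
  then obtain u v u' v' where "u * f + v * g b = 1" "u' * f + v' * (\<Prod>b\<in>I. g b) = 1"
    by (metis insert_iff)
  then have "(u * f + v * g b) * (u' * f + v' * (\<Prod>b\<in>I. g b)) = 1" by simp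
  then have "(u * (u' * f + v' * (\<Prod>b\<in>I. g b)) + v * g b * u') * f + (v * v') * (g b * (\<Prod>b\<in>I. g b)) = 1"
    by (simp add: algebra_simps)
  then show ?case using insert.hyps by auto
qed

text \<open>Testing the vanishing sums against multiples of the product q of the other binomials isolates the
  sequence t a, and q is invertible modulo the binomial of a.\<close>

lemma binomial_recurrences_independent:
  fixes t :: "'i \<Rightarrow> nat \<Rightarrow> real"
  assumes I: "finite I"
    and pos: "\<And>a. a \<in> I \<Longrightarrow> d a > 0"
    and rec: "\<And>a k. a \<in> I \<Longrightarrow> t a (k + d a) = \<sigma> a * t a k"
    and distinct: "\<And>a b. a \<in> I \<Longrightarrow> b \<in> I \<Longrightarrow> a \<noteq> b \<Longrightarrow> \<sigma> a ^ d b \<noteq> \<sigma> b ^ d a"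
    and sum0: "\<And>k. k < (\<Sum>a\<in>I. d a) \<Longrightarrow> (\<Sum>a\<in>I. t a k) = 0"
    and a: "a \<in> I"
  shows "t a k = 0"
proof -
  define F where "F b = monom 1 (d b) - [:\<sigma> b:]" for b
  define q where "q = (\<Prod>b\<in>I - {a}. F b)"
  have deg_F: "degree (F b) \<le> d b" for b
    unfolding F_def by (intro degree_diff_le degree_monom_le) simp
  have "degree q \<le> (\<Sum>b\<in>I - {a}. d b)"
    unfolding q_def by (rule order_trans[OF degree_prod_sum_le]) (use I deg_F in \<open>auto intro: sum_mono\<close>)
  then have deg_q: "degree q + d a \<le> (\<Sum>b\<in>I. d b)"
    by (subst sum.remove[OF I a]) simp
  have kill: "umbral (t b) (F b * p) = 0" if "b \<in> I" for b p
    unfolding F_def by (rule umbral_recurrence) (rule rec[OF that])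
  \<comment> \<open>Each other \<open>F b\<close> divides \<open>x^m * q\<close>, so only
    \<open>t a\<close> contributes to the sum. The bound \<open>m < d a\<close> keeps the degree
    below the number of vanishing sums in \<open>sum0\<close>.\<close>
  have zero: "umbral (t a) (monom 1 m * q) = 0" if m: "m < d a" for m
  proof -
    let ?p = "monom 1 m * q"
    have "umbral (t b) ?p = 0" if b: "b \<in> I - {a}" for b
    proof -
      have "?p = F b * (monom 1 m * (\<Prod>b\<in>I - {a} - {b}. F b))"
        unfolding q_def using I b by (subst prod.remove[of _ b]) (auto simp: mult_ac)
      then show ?thesis using kill b by (metis DiffD1)
    qed
    then have "umbral (t a) ?p = (\<Sum>b\<in>I. umbral (t b) ?p)"
      by (subst sum.remove[OF I a]) simp
    also have "\<dots> = (\<Sum>i\<le>degree ?p. coeff ?p i * (\<Sum>b\<in>I. t b i))"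
      unfolding umbral_def by (subst sum.swap) (simp add: sum_distrib_left)
    also have "\<dots> = 0"
    proof -
      have "degree ?p \<le> m + degree q"
        using degree_mult_le[of "monom 1 m" q] degree_monom_le[of "1::real" m] by linarith
      then show ?thesis using sum0 m deg_q by (intro sum.neutral) auto
    qed
    finally show ?thesis .
  qed
  \<comment> \<open>The \<open>d a\<close> shifts just treated determine all others through the
    recurrence of \<open>t a\<close>.\<close>
  have "umbral (\<lambda>k. t a (k + m)) q = 0" for m
  proof (induction m rule: less_induct)
    case (less m)
    show ?case
    proof (cases "m < d a")
      case True
      then show ?thesis using zero by (simp add: umbral_monom_mult)
    next
      case False
      have "t a (k + m) = \<sigma> a * t a (k + (m - d a))" for k
        using rec[OF a, of "k + (m - d a)"] False by simp
      then show ?thesis using less.IH[of "m - d a"] pos[OF a] False by (simp add: umbral_scale)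
    qed
  qed
  then have q: "umbral (t a) (p * q) = 0" for p by (rule umbral_mult_zero)
  obtain u v where uv: "u * F a + v * q = 1"
    using bezout_prod[of "I - {a}" "F a" F] I a distinct
    unfolding q_def F_def by (metis Diff_iff bezout_binomials finite_Diff singletonI)
  \<comment> \<open>The Bezout relation splits \<open>x^k\<close> into a multiple of
    \<open>F a\<close> and a multiple of \<open>q\<close>, both of which are killed.\<close>
  have "t a k = umbral (t a) (monom 1 k * 1)"
    unfolding umbral_monom_mult by (simp add: umbral_def)
  also have "monom 1 k * 1 = F a * (monom 1 k * u) + (monom 1 k * v) * q"
    unfolding uv[symmetric] by (simp add: algebra_simps)
  also have "umbral (t a) \<dots> = 0"
    unfolding umbral_add q kill[OF a] by simp
  finally show ?thesis .
qed

subsection \<open>Weighted permutation matrices\<close>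

definition cyclic_matrix :: "('n \<Rightarrow> 'n) \<Rightarrow> ('n \<Rightarrow> real) \<Rightarrow> real^'n^'n" where
  "cyclic_matrix \<pi> w = (\<chi> i j. if j = \<pi> i then w i else 0)"

text \<open>The only entry in row \<open>i\<close> of the \<open>k\<close>-th power of
  \<open>cyclic_matrix \<pi> w\<close> that can be nonzero; it stands in column
  \<open>(\<pi> ^^ k) i\<close>.\<close>

definition path_weight :: "('n \<Rightarrow> 'n) \<Rightarrow> ('n \<Rightarrow> real) \<Rightarrow> nat \<Rightarrow> 'n \<Rightarrow> real" where
  "path_weight \<pi> w k i = (\<Prod>l<k. w ((\<pi> ^^ l) i))"

lemma path_weight_0 [simp]: "path_weight \<pi> w 0 i = 1"
  by (simp add: path_weight_def)

lemma path_weight_Suc: "path_weight \<pi> w (Suc k) i = path_weight \<pi> w k i * w ((\<pi> ^^ k) i)"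
  by (simp add: path_weight_def)

lemma path_weight_Suc': "path_weight \<pi> w (Suc k) i = w i * path_weight \<pi> w k (\<pi> i)"
  unfolding path_weight_def prod.lessThan_Suc_shift by (simp add: funpow_swap1)

lemma path_weight_add:
  "path_weight \<pi> w (k + m) i = path_weight \<pi> w k i * path_weight \<pi> w m ((\<pi> ^^ k) i)"
  by (induction m) (simp_all add: path_weight_Suc funpow_add[symmetric, THEN fun_cong, unfolded comp_def] add.commute mult.assoc)

lemma mat_pow_cyclic_matrix:
  "mat_pow (cyclic_matrix \<pi> w) k $ i $ j = (if j = (\<pi> ^^ k) i then path_weight \<pi> w k i else 0)"
proof (induction k arbitrary: i)
  case 0
  then show ?case by (auto simp: mat_def)
next
  case (Suc k)
  have "mat_pow (cyclic_matrix \<pi> w) (Suc k) $ i $ j = w i * mat_pow (cyclic_matrix \<pi> w) k $ \<pi> i $ j"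
    by (simp add: matrix_matrix_mult_def cyclic_matrix_def if_distribR if_distrib cong: if_cong)
  then show ?case using Suc by (simp add: path_weight_Suc' funpow_swap1)
qed

lemma trace_mult_mat_pow_cyclic_matrix:
  "trace (Y ** mat_pow (cyclic_matrix \<pi> w) k) = (\<Sum>i\<in>UNIV. Y $ (\<pi> ^^ k) i $ i * path_weight \<pi> w k i)"
proof -
  have "trace (Y ** mat_pow (cyclic_matrix \<pi> w) k) =
      (\<Sum>i\<in>UNIV. \<Sum>j\<in>UNIV. Y $ i $ j * mat_pow (cyclic_matrix \<pi> w) k $ j $ i)"
    by (simp add: trace_def matrix_matrix_mult_def)
  also have "\<dots> = (\<Sum>j\<in>UNIV. \<Sum>i\<in>UNIV. Y $ i $ j * mat_pow (cyclic_matrix \<pi> w) k $ j $ i)"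
    by (rule sum.swap)
  also have "\<dots> = (\<Sum>j\<in>UNIV. Y $ (\<pi> ^^ k) j $ j * path_weight \<pi> w k j)"
    by (simp add: mat_pow_cyclic_matrix if_distrib cong: if_cong)
  finally show ?thesis .
qed

text \<open>The size of the orbit equals the return time \<open>funpow_dist1 \<pi> i i\<close>. As a
  period it depends on the orbit alone and not on a base point, which allows sequences indexed by
  orbits.\<close>

lemma orbit_eq_image_card:
  assumes "permutation \<pi>"
  shows "orbit \<pi> i = (\<lambda>l. (\<pi> ^^ l) i) ` {..<card (orbit \<pi> i)}"
    "inj_on (\<lambda>l. (\<pi> ^^ l) i) {..<card (orbit \<pi> i)}"
    "(\<pi> ^^ card (orbit \<pi> i)) i = i"
proof -
  have self: "i \<in> orbit \<pi> i" using assms by (rule permutation_self_in_orbit)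
  have "card (orbit \<pi> i) = funpow_dist1 \<pi> i i"
    by (subst orbit_conv_funpow_dist1[OF self], subst card_image[OF inj_on_funpow_dist1[OF self]]) simp
  then show "orbit \<pi> i = (\<lambda>l. (\<pi> ^^ l) i) ` {..<card (orbit \<pi> i)}"
    "inj_on (\<lambda>l. (\<pi> ^^ l) i) {..<card (orbit \<pi> i)}"
    "(\<pi> ^^ card (orbit \<pi> i)) i = i"
    using orbit_conv_funpow_dist1[OF self] inj_on_funpow_dist1[OF self] funpow_dist1_prop[OF self]
    by (simp_all only: lessThan_atLeast0)
qed

lemma path_weight_orbit:
  assumes "permutation \<pi>"
  shows "path_weight \<pi> w (card (orbit \<pi> i)) i = (\<Prod>j\<in>orbit \<pi> i. w j)"
  unfolding path_weight_def
  by (subst (2) orbit_eq_image_card(1)[OF assms]) (simp add: prod.reindex orbit_eq_image_card(2)[OF assms])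

text \<open>Written for \<open>Y = transpose X\<close>, with the commutation and trace conditions
  only. These are continuous in \<open>A\<close> and blind to its support, so the property implies
  \<open>nSMP\<close> and passes to nearby matrices with more nonzero entries.\<close>

definition commutant_trivial :: "real^'n^'n \<Rightarrow> bool" where
  "commutant_trivial A \<longleftrightarrow>
    (\<forall>Y. A ** Y = Y ** A \<and> (\<forall>k < CARD('n). trace (Y ** mat_pow A k) = 0) \<longrightarrow> Y = 0)"

lemma commutant_trivial_imp_nSMP: "commutant_trivial A \<Longrightarrow> nSMP A"
  unfolding nSMP_def
proof (intro allI impI, elim conjE)
  fix X
  assume "commutant_trivial A" "A ** transpose X - transpose X ** A = 0"
    "\<forall>k<CARD('a). trace (transpose X ** mat_pow A k) = 0"
  then have "transpose X = 0" unfolding commutant_trivial_def by simp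
  then show "X = 0" by (simp add: transpose_def vec_eq_iff)
qed

lemma orbit_eq_of_mem:
  "permutation \<pi> \<Longrightarrow> j \<in> orbit \<pi> i \<Longrightarrow> orbit \<pi> j = orbit \<pi> i"
  by (rule orbit_cyclic_eq3[OF cyclic_on_orbit'])

text \<open>Entries of \<open>Y\<close> joining different orbits vanish by comparing weights of
  walks that close both orbits. The diagonal entries of \<open>Y\<close> times the
  \<open>k\<close>-th power are constant along each orbit and gain the product of its weights when
  \<open>k\<close> grows by its size; the trace conditions then feed
  \<open>binomial_recurrences_independent\<close>.\<close>

lemma commutant_trivial_cyclic_matrix:
  fixes w :: "'n::finite \<Rightarrow> real"
  assumes \<pi>: "permutation \<pi>"
    and abs_w: "\<And>i j. \<bar>w i\<bar> = \<bar>w j\<bar> \<longleftrightarrow> orbit \<pi> i = orbit \<pi> j"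
    and w0: "\<And>i. w i = 0 \<Longrightarrow> \<pi> i = i"
  shows "commutant_trivial (cyclic_matrix \<pi> w)"
  unfolding commutant_trivial_def
proof (intro allI impI, elim conjE)
  fix Y
  assume comm: "cyclic_matrix \<pi> w ** Y = Y ** cyclic_matrix \<pi> w"
    and tr: "\<forall>k < CARD('n). trace (Y ** mat_pow (cyclic_matrix \<pi> w) k) = 0"
  note orbit_self = permutation_self_in_orbit[OF \<pi>]
  note orbit_eq = orbit_eq_of_mem[OF \<pi>]
  define W where "W = path_weight \<pi> w"
  have "inj \<pi>" using \<pi> by (simp add: permutation_bijective bij_is_inj)
  have step: "w i * Y $ \<pi> i $ \<pi> j = Y $ i $ j * w j" for i j
  proof -
    have "(cyclic_matrix \<pi> w ** Y) $ i $ \<pi> j = w i * Y $ \<pi> i $ \<pi> j"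
      by (simp add: matrix_matrix_mult_def cyclic_matrix_def if_distribR if_distrib cong: if_cong)
    moreover have "(Y ** cyclic_matrix \<pi> w) $ i $ \<pi> j = Y $ i $ j * w j"
      using \<open>inj \<pi>\<close>
      by (simp add: matrix_matrix_mult_def cyclic_matrix_def inj_eq if_distrib cong: if_cong)
    ultimately show ?thesis using comm by simp
  qed
  have steps: "W m i * Y $ (\<pi> ^^ m) i $ (\<pi> ^^ m) j = Y $ i $ j * W m j" for m i j
  proof (induction m)
    case (Suc m)
    have "W (Suc m) i * Y $ (\<pi> ^^ Suc m) i $ (\<pi> ^^ Suc m) j
        = W m i * (w ((\<pi> ^^ m) i) * Y $ \<pi> ((\<pi> ^^ m) i) $ \<pi> ((\<pi> ^^ m) j))"
      by (simp add: W_def path_weight_Suc)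
    also have "\<dots> = (W m i * Y $ (\<pi> ^^ m) i $ (\<pi> ^^ m) j) * w ((\<pi> ^^ m) j)"
      by (simp only: step mult.assoc)
    also have "\<dots> = Y $ i $ j * (W m j * w ((\<pi> ^^ m) j))"
      by (simp only: Suc.IH mult.assoc)
    finally show ?case by (simp only: W_def path_weight_Suc)
  qed (simp add: W_def)
  have in_orbit: "(\<pi> ^^ l) i \<in> orbit \<pi> i" for l i
    using orbit_self by (rule funpow_in_orbit)
  have abs_W: "\<bar>W m i\<bar> = \<bar>w i\<bar> ^ m" for m i
  proof -
    have "\<bar>w ((\<pi> ^^ l) i)\<bar> = \<bar>w i\<bar>" for l
      using abs_w orbit_eq[OF in_orbit] by blast
    then show ?thesis by (simp add: W_def path_weight_def abs_prod)
  qed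
  have off: "Y $ i $ j = 0" if "orbit \<pi> i \<noteq> orbit \<pi> j" for i j
  proof -
    \<comment> \<open>After \<open>m\<close> steps both indices have returned, so
      \<open>steps\<close> relates \<open>Y $ i $ j\<close> to itself, with factors of different
      absolute value.\<close>
    define m where "m = card (orbit \<pi> i) * card (orbit \<pi> j)"
    have period: "(\<pi> ^^ (card (orbit \<pi> i) * c)) i = i" for c i
      by (induction c) (simp_all add: funpow_add orbit_eq_image_card(3)[OF \<pi>])
    have "(\<pi> ^^ m) i = i" "(\<pi> ^^ m) j = j"
      using period[of i "card (orbit \<pi> j)"] period[of j "card (orbit \<pi> i)"]
      by (simp_all add: m_def mult.commute)
    then have "W m i * Y $ i $ j = Y $ i $ j * W m j" using steps[of m i j] by simp
    moreover have "m > 0"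
      using orbit_self by (auto simp: m_def card_gt_0_iff)
    then have "\<bar>w i\<bar> ^ m \<noteq> \<bar>w j\<bar> ^ m"
      using abs_w that by (metis abs_ge_zero power_eq_imp_eq_base)
    then have "W m i \<noteq> W m j" using abs_W by metis
    ultimately show ?thesis by simp
  qed
  \<comment> \<open>The diagonal entry of \<open>Y\<close> times the \<open>k\<close>-th power at
    position \<open>(\<pi> ^^ k) i\<close>, indexed by the start \<open>i\<close> of the
    walk.\<close>
  define f where "f k i = Y $ (\<pi> ^^ k) i $ i * W k i" for k i
  have f_step: "f k (\<pi> i) = f k i" for k i
  \<comment> \<open>A zero weight cannot be cancelled, but it occurs only at a fixed point.\<close>
  proof (cases "w i = 0")
    case True
    then show ?thesis using w0 by simp
  next
    case False
    have "w i * f k (\<pi> i) = (Y $ \<pi> ((\<pi> ^^ k) i) $ \<pi> i) * (w i * W k (\<pi> i))"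
      by (simp add: f_def funpow_swap1)
    also have "w i * W k (\<pi> i) = w ((\<pi> ^^ k) i) * W k i"
      unfolding W_def by (metis path_weight_Suc path_weight_Suc' mult.commute)
    also have "Y $ \<pi> ((\<pi> ^^ k) i) $ \<pi> i * (w ((\<pi> ^^ k) i) * W k i)
        = (w ((\<pi> ^^ k) i) * Y $ \<pi> ((\<pi> ^^ k) i) $ \<pi> i) * W k i" by simp
    also have "\<dots> = w i * f k i" by (simp only: step f_def mult_ac)
    finally show ?thesis using False by simp
  qed
  have f_orbit: "f k j = f k i" if "j \<in> orbit \<pi> i" for k i j
    using that by induction (simp_all add: f_step)
  define t where "t Q k = (\<Sum>i\<in>Q. f k i)" for Q k
  have part: "(\<Sum>Q\<in>range (orbit \<pi>). \<Sum>i\<in>Q. g i) = (\<Sum>i\<in>UNIV. g i)" for g :: "'n \<Rightarrow> 'b::comm_monoid_add"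
  proof -
    have "\<forall>Q\<in>range (orbit \<pi>). \<forall>R\<in>range (orbit \<pi>). Q \<noteq> R \<longrightarrow> Q \<inter> R = {}"
      using orbit_eq by blast
    then have "sum g (\<Union>(range (orbit \<pi>))) = (\<Sum>Q\<in>range (orbit \<pi>). sum g Q)"
      by (subst sum.Union_disjoint) auto
    moreover have "\<Union>(range (orbit \<pi>)) = UNIV" using orbit_self by blast
    ultimately show ?thesis by simp
  qed
  have "t Q k = 0" if "Q \<in> range (orbit \<pi>)" for Q k
  proof (rule binomial_recurrences_independent[of "range (orbit \<pi>)" card t "\<lambda>Q. \<Prod>j\<in>Q. w j" Q k])
    show "card Q > 0" if "Q \<in> range (orbit \<pi>)" for Q
      using that orbit_self by (auto simp: card_gt_0_iff)
    show "t Q (k + card Q) = (\<Prod>j\<in>Q. w j) * t Q k" if Q: "Q \<in> range (orbit \<pi>)" for Q k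
    proof -
      have "f (k + card Q) i = (\<Prod>j\<in>Q. w j) * f k i" if "i \<in> Q" for i
      proof -
        have Qi: "Q = orbit \<pi> i" using Q that orbit_eq by blast
        then have Qk: "Q = orbit \<pi> ((\<pi> ^^ k) i)" using orbit_eq[OF in_orbit] by simp
        have "(\<pi> ^^ (k + card Q)) i = (\<pi> ^^ k) i"
          using orbit_eq_image_card(3)[OF \<pi>, of i] Qi by (simp add: funpow_add)
        moreover have "W (k + card Q) i = W k i * (\<Prod>j\<in>Q. w j)"
          unfolding W_def path_weight_add using path_weight_orbit[OF \<pi>, of w "(\<pi> ^^ k) i"] Qk by simp
        ultimately show ?thesis by (simp add: f_def)
      qed
      then show ?thesis by (simp add: t_def sum_distrib_left)
    qed
    show "(\<Prod>j\<in>Q. w j) ^ card R \<noteq> (\<Prod>j\<in>R. w j) ^ card Q"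
      if QR: "Q \<in> range (orbit \<pi>)" "R \<in> range (orbit \<pi>)" "Q \<noteq> R" for Q R
    proof
      assume eq: "(\<Prod>j\<in>Q. w j) ^ card R = (\<Prod>j\<in>R. w j) ^ card Q"
      obtain a b where ab: "Q = orbit \<pi> a" "R = orbit \<pi> b" using QR(1,2) by blast
      \<comment> \<open>At the common exponent \<open>card Q * card R\<close> the absolute weights
        of the two orbits can be compared.\<close>
      have "\<bar>w a\<bar> ^ (card Q * card R) = \<bar>(\<Prod>j\<in>Q. w j) ^ card R\<bar>"
        using abs_W[of "card Q" a] path_weight_orbit[OF \<pi>, of w a] ab
        by (simp add: W_def power_mult power_abs)
      moreover have "\<bar>w b\<bar> ^ (card R * card Q) = \<bar>(\<Prod>j\<in>R. w j) ^ card Q\<bar>"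
        using abs_W[of "card R" b] path_weight_orbit[OF \<pi>, of w b] ab
        by (simp add: W_def power_mult power_abs)
      ultimately have "\<bar>w a\<bar> ^ (card Q * card R) = \<bar>w b\<bar> ^ (card Q * card R)"
        using eq by (simp add: mult.commute)
      moreover have "card Q * card R > 0"
        using ab orbit_self by (auto simp: card_gt_0_iff)
      ultimately have "\<bar>w a\<bar> = \<bar>w b\<bar>" by (metis abs_ge_zero power_eq_imp_eq_base)
      then show False using abs_w ab QR(3) by simp
    qed
    show "(\<Sum>Q\<in>range (orbit \<pi>). t Q k) = 0" if k: "k < (\<Sum>Q\<in>range (orbit \<pi>). card Q)" for k
    proof -
      \<comment> \<open>The orbit sizes add up to the order of the matrix, so the trace conditions
        supply exactly the required number of vanishing sums.\<close>
      have "(\<Sum>Q\<in>range (orbit \<pi>). card Q) = CARD('n)"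
        using part[of "\<lambda>_. 1::nat"] by simp
      then have "trace (Y ** mat_pow (cyclic_matrix \<pi> w) k) = 0" using tr k by simp
      then show ?thesis unfolding t_def part by (simp add: trace_mult_mat_pow_cyclic_matrix f_def W_def)
    qed
  qed (use that in auto)
  moreover have "t (orbit \<pi> i) k = card (orbit \<pi> i) * f k i" for i k
    using f_orbit by (simp add: t_def)
  ultimately have f0: "f k i = 0" for k i
    by (simp add: orbit_nonempty)
  have "Y $ i $ j = 0" for i j
  proof (cases "orbit \<pi> i = orbit \<pi> j")
    case True
    then have "i \<in> orbit \<pi> j" using orbit_self by blast
    then obtain k where k: "i = (\<pi> ^^ k) j" using orbit_altdef_permutation[OF \<pi>] by blast
    show ?thesis
    \<comment> \<open>Path weights of positive length vanish at a fixed point of weight 0; there the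
      empty walk, of path weight 1, gives the diagonal entry.\<close>
    proof (cases "w j = 0")
      case True
      then have "orbit \<pi> j = {j}" using w0 by (simp add: orbit_eq_singleton_iff)
      then have "i = j" using \<open>i \<in> orbit \<pi> j\<close> by simp
      then show ?thesis using f0[of 0 j] by (simp add: f_def W_def)
    next
      case False
      then have "W k j \<noteq> 0" using abs_W[of k j] by auto
      then show ?thesis using f0[of k j] k by (simp add: f_def)
    qed
  qed (rule off)
  then show "Y = 0" by (simp add: vec_eq_iff)
qed

subsection \<open>Perturbation\<close>

lemma tendsto_matrix_matrix_mult:
  fixes A :: "'a \<Rightarrow> real^'n^'m" and B :: "'a \<Rightarrow> real^'k^'n"
  assumes "(A \<longlongrightarrow> C) F" "(B \<longlongrightarrow> D) F"
  shows "((\<lambda>t. A t ** B t) \<longlongrightarrow> C ** D) F"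
  unfolding matrix_matrix_mult_def by (intro tendsto_intros assms)

lemma tendsto_mat_pow:
  assumes "(A \<longlongrightarrow> B) F"
  shows "((\<lambda>t. mat_pow (A t) k) \<longlongrightarrow> mat_pow B k) F"
  by (induction k) (auto intro: tendsto_matrix_matrix_mult assms)

lemma tendsto_trace:
  fixes A :: "'a \<Rightarrow> real^'n^'n"
  assumes "(A \<longlongrightarrow> B) F"
  shows "((\<lambda>t. trace (A t)) \<longlongrightarrow> trace B) F"
  unfolding trace_def by (intro tendsto_intros assms)

lemma matrix_scaleR_mult:
  fixes A :: "real^'n^'m" and B :: "real^'k^'n"
  shows "(c *\<^sub>R A) ** B = c *\<^sub>R (A ** B)" "A ** (c *\<^sub>R B) = c *\<^sub>R (A ** B)"
  by (simp_all add: matrix_matrix_mult_def vec_eq_iff sum_distrib_left mult_ac)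

lemma trace_scaleR: "trace (c *\<^sub>R A) = c * trace A" for A :: "real^'n^'n"
  by (simp add: trace_def sum_distrib_left)

text \<open>The conditions are linear in \<open>Y\<close>, so nonzero solutions for every
  \<open>A m\<close> can be normalized; by compactness they accumulate at a unit solution for
  \<open>B\<close>.\<close>

lemma commutant_trivial_limit:
  fixes A :: "nat \<Rightarrow> real^'n^'n"
  assumes lim: "A \<longlonglongrightarrow> B" and B: "commutant_trivial B"
  shows "\<exists>m. commutant_trivial (A m)"
proof (rule ccontr)
  assume "\<not> ?thesis"
  then have "\<exists>Y. Y \<noteq> 0 \<and> A m ** Y = Y ** A m \<and> (\<forall>k < CARD('n). trace (Y ** mat_pow (A m) k) = 0)" for m
    unfolding commutant_trivial_def by blast
  then obtain Z where Z: "\<And>m. Z m \<noteq> 0" "\<And>m. A m ** Z m = Z m ** A m"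
    "\<And>m k. k < CARD('n) \<Longrightarrow> trace (Z m ** mat_pow (A m) k) = 0"
    by metis
  define Y where "Y m = Z m /\<^sub>R norm (Z m)" for m
  have Y: "A m ** Y m = Y m ** A m" "k < CARD('n) \<Longrightarrow> trace (Y m ** mat_pow (A m) k) = 0" for m k
    using Z(2,3) by (simp_all add: Y_def matrix_scaleR_mult trace_scaleR)
  have "\<forall>m. Y m \<in> sphere 0 1" using Z(1) by (simp add: Y_def)
  then obtain X and r :: "nat \<Rightarrow> nat" where X: "X \<in> sphere 0 1" and r: "strict_mono r"
    and Yr: "(Y \<circ> r) \<longlonglongrightarrow> X"
    using seq_compactE[OF compact_imp_seq_compact[OF compact_sphere]] by metis
  have lims: "(\<lambda>m. Y (r m)) \<longlonglongrightarrow> X" "(\<lambda>m. A (r m)) \<longlonglongrightarrow> B"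
    using Yr LIMSEQ_subseq_LIMSEQ[OF lim r] by (simp_all add: comp_def)
  have "B ** X = X ** B"
    using tendsto_matrix_matrix_mult[OF lims(2,1)] tendsto_matrix_matrix_mult[OF lims]
    unfolding Y(1) by (rule LIMSEQ_unique)
  moreover have "trace (X ** mat_pow B k) = 0" if "k < CARD('n)" for k
    using tendsto_trace[OF tendsto_matrix_matrix_mult[OF lims(1) tendsto_mat_pow[OF lims(2), of k]]]
    by (simp add: Y(2)[OF that] LIMSEQ_const_iff)
  ultimately have "X = 0" using B unfolding commutant_trivial_def by blast
  then show False using X by simp
qed

section \<open>A matrix with the prescribed signs\<close>

primrec sign_value :: "sign \<Rightarrow> real" where
  "sign_value Pos = 1"
| "sign_value Neg = -1"
| "sign_value Zero = 0"

lemma sign_value_eq_0_iff: "sign_value s = 0 \<longleftrightarrow> s = Zero"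
  by (cases s) auto

lemma abs_sign_value: "\<bar>sign_value s\<bar> = (if s = Zero then 0 else 1)"
  by (cases s) auto

lemma has_sign_mult_sign_value: "c > 0 \<Longrightarrow> has_sign (c * sign_value s) s"
  by (cases s) auto

text \<open>A weighted permutation matrix supplies \<open>commutant_trivial\<close>; adding a small
  positive multiple of the sign matrix fills the pattern.\<close>

lemma near_cover_imp_nSMP:
  fixes P :: "sign^'n^'n"
  assumes "near_cover P"
  shows "\<exists>A \<in> qual_class P. nSMP A"
proof -
  obtain \<pi> z where \<pi>: "\<pi> permutes UNIV" and z: "\<And>i. P $ i $ \<pi> i = Zero \<Longrightarrow> i = z \<and> \<pi> i = i"
    using assms unfolding near_cover_def by blast
  have perm: "permutation \<pi>" using \<pi> by (auto simp: permutation_permutes)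
  obtain g :: "'n set \<Rightarrow> nat" where g: "inj g"
    using finite_imp_inj_to_nat_seg[of "UNIV :: 'n set set"] by auto
  \<comment> \<open>The injective numbering \<open>g\<close> separates orbits; the summand 1 keeps
    \<open>c\<close> positive, so that weight 0 is reserved for a \<open>Zero\<close> entry.\<close>
  define c where "c i = 1 + real (g (orbit \<pi> i))" for i
  have c_pos: "c i > 0" for i by (simp add: c_def add_pos_nonneg)
  have c_eq: "c i = c j \<longleftrightarrow> orbit \<pi> i = orbit \<pi> j" for i j
    using g by (auto simp: c_def dest: injD)
  define w where "w i = c i * sign_value (P $ i $ \<pi> i)" for i
  have w0: "w i = 0 \<longleftrightarrow> P $ i $ \<pi> i = Zero" for i
    using c_pos[of i] by (simp add: w_def sign_value_eq_0_iff)
  have abs_w: "\<bar>w i\<bar> = \<bar>w j\<bar> \<longleftrightarrow> orbit \<pi> i = orbit \<pi> j" for i j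
  proof (cases "P $ i $ \<pi> i = Zero \<or> P $ j $ \<pi> j = Zero")
    case True
    have fixed: "i = j" if "P $ i $ \<pi> i = Zero" "orbit \<pi> i = orbit \<pi> j" for i j
    proof -
      have "orbit \<pi> i = {i}" using z[OF that(1)] by (auto simp: orbit_eq_singleton_iff)
      then show ?thesis using permutation_self_in_orbit[OF perm, of j] that(2) by simp
    qed
    \<comment> \<open>One of the weights is 0, so equal absolute values make both 0, and then both
      indices are \<open>z\<close>.\<close>
    have "\<bar>w i\<bar> = \<bar>w j\<bar> \<longleftrightarrow> P $ i $ \<pi> i = Zero \<and> P $ j $ \<pi> j = Zero"
      using True w0[of i] w0[of j] by auto
    also have "\<dots> \<longleftrightarrow> i = j" using True z by blast
    also have "\<dots> \<longleftrightarrow> orbit \<pi> i = orbit \<pi> j" using True fixed[of i j] fixed[of j i] by auto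
    finally show ?thesis .
  next
    case False
    then show ?thesis using c_pos[of i] c_pos[of j] by (simp add: w_def abs_mult abs_sign_value c_eq)
  qed
  define A0 where "A0 = cyclic_matrix \<pi> w"
  define S :: "real^'n^'n" where "S = (\<chi> i j. sign_value (P $ i $ j))"
  define A where "A m = A0 + (1 / Suc m) *\<^sub>R S" for m
  have "commutant_trivial A0"
    unfolding A0_def using perm abs_w
    by (rule commutant_trivial_cyclic_matrix) (use w0 z in blast)
  moreover have "A \<longlonglongrightarrow> A0"
  proof -
    have "A \<longlonglongrightarrow> A0 + 0 *\<^sub>R S"
      unfolding A_def by (intro tendsto_intros LIMSEQ_Suc[OF lim_inverse_n'])
    then show ?thesis by simp
  qed
  ultimately obtain m where m: "commutant_trivial (A m)" using commutant_trivial_limit by blast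
  \<comment> \<open>Both summands carry the sign of the pattern, so nothing cancels, and
    \<open>Zero\<close> entries stay 0, including the one allowed along
    \<open>\<pi>\<close>.\<close>
  have "A m $ i $ j = ((if j = \<pi> i then c i else 0) + 1 / Suc m) * sign_value (P $ i $ j)" for i j
    by (simp add: A_def A0_def S_def cyclic_matrix_def w_def algebra_simps)
  moreover have "(if j = \<pi> i then c i else 0) + 1 / real (Suc m) > 0" for i j
    using c_pos[of i] by (simp add: add_pos_pos)
  ultimately have "A m \<in> qual_class P"
    by (simp add: qual_class_def has_sign_mult_sign_value)
  then show ?thesis using commutant_trivial_imp_nSMP[OF m] by blast
qed

theorem corollary4p2:
  fixes P :: "sign^'n^'n"
  shows "allows P nSMP \<longleftrightarrow>
    max_composite_cycle_length (pattern_digraph P) \<ge> CARD('n) - 1"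
  unfolding allows_def max_composite_cycle_length_ge_iff
  using nSMP_imp_near_cover near_cover_imp_nSMP by blast

end
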